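(* Let $R$ be a ring and let $\Gamma'(R)$ be the unity product graph associated with $R$. If $R\cong\mathbb{Z}_{2^m}$, where $m\geq 3$ is an integer, then $\Gamma'(R)$ contains exactly four isolated vertices.
   Context: $\mathbb{Z}_{n}$ is the ring of integers modulo $n$. For a ring $R$ with unity $e$, let $U(R)$ denote the set of units of $R$. The unity product graph $\Gamma'(R)$ is the simple graph with vertex set $U(R)$ in which two distinct vertices $r_i,r_j$ are adjacent if and only if $r_i\cdot r_j=e$. A vertex is isolated if no edge is incident to it. *)

theory Defs
  imports "HOL-Number_Theory.Residues" "HOL-Algebra.QuotRing" "Graph_Theory.Pair_Digraph"
begin

text \<open>A simple graph is represented, as usual in the graph library, by a loopfree symmetric
  digraph without parallel arcs: each edge \<open>{r, s}\<close> appears as the two arcs \<open>(r, s)\<close>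
  and \<open>(s, r)\<close>.  Symmetry is not built into the arc set; it holds for every ring
  (commutative or not) because the vertices are two-sided units, see below.\<close>

definition unity_product_graph :: "('a, 'b) ring_scheme \<Rightarrow> 'a pair_pre_digraph" where
  "unity_product_graph R =
     \<lparr> pverts = Units R,
       parcs = {(r, s). r \<in> Units R \<and> s \<in> Units R \<and> r \<noteq> s \<and> r \<otimes>\<^bsub>R\<^esub> s = \<one>\<^bsub>R\<^esub>} \<rparr>"

lemma (in ring) unity_product_graph_simple:
  "pair_bidirected_digraph (unity_product_graph R)"
proof unfold_locales
  show "symmetric (with_proj (unity_product_graph R))"
    unfolding symmetric_def with_proj_simps
    by (rule symI) (auto simp: unity_product_graph_def Units_closed intro: Units_inv_comm)
qed (auto simp: unity_product_graph_def)

lemma (in ring) unity_product_graph_pair_graph: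
  assumes "finite (Units R)"
  shows "pair_graph (unity_product_graph R)"
proof -
  interpret pair_bidirected_digraph "unity_product_graph R"
    by (rule unity_product_graph_simple)
  have "parcs (unity_product_graph R) \<subseteq> Units R \<times> Units R"
    by (auto simp: unity_product_graph_def)
  hence "finite (parcs (unity_product_graph R))"
    using assms by (meson finite_SigmaI finite_subset)
  thus ?thesis
    using assms by unfold_locales (auto simp: unity_product_graph_def)
qed

definition isolated_vertices :: "('v, 'e) pre_digraph \<Rightarrow> 'v set" where
  "isolated_vertices G = {v \<in> verts G. in_arcs G v = {} \<and> out_arcs G v = {}}"

end

theory Submission
  imports Defs
begin

text \<open>
  Inverses in a ring are unique, so a unit \<open>u\<close> has at most one possible neighbour, namely its
  inverse; it is isolated exactly when that neighbour is \<open>u\<close> itself, which would be a loop.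
  The isolated vertices are therefore the solutions of \<open>u\<^sup>2 = 1\<close>
  (\<open>isolated_vertices_unity_product_graph\<close>), and their number is an isomorphism invariant
  (\<open>card_square_roots_of_one_ring_iso\<close>).

  It remains to solve \<open>x\<^sup>2 \<equiv> 1\<close> modulo \<open>2\<^sup>m\<close>. A solution is odd, and writing \<open>x = 2 y + 1\<close>
  turns the congruence into \<open>2\<^bsup>m-2\<^esup> dvd y (y + 1)\<close>. The two factors are coprime, so one of them
  absorbs the whole power of two, that is, \<open>x \<equiv> \<plusminus>1\<close> modulo \<open>2\<^bsup>m-1\<^esup>\<close>. Each of these two classes
  modulo \<open>2\<^bsup>m-1\<^esup>\<close> consists of two classes modulo \<open>2\<^sup>m\<close>, and the four residues obtained are
  distinct because \<open>m \<ge> 3\<close>.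
\<close>

text \<open>An isolated unit cannot be joined to its inverse, so it equals its inverse; conversely a
  self-inverse element has, by uniqueness of inverses, only itself as a candidate neighbour.\<close>

lemma (in ring) isolated_vertices_unity_product_graph:
  "isolated_vertices (with_proj (unity_product_graph R)) =
     {u \<in> carrier R. u \<otimes> u = \<one>}"  (is "?I = ?S")
proof
  show "?I \<subseteq> ?S"
  proof
    fix u assume u: "u \<in> ?I"
    then have unit: "u \<in> Units R"
      and no_out: "out_arcs (with_proj (unity_product_graph R)) u = {}"
      by (auto simp: isolated_vertices_def unity_product_graph_def)
    have "u = inv u"
    proof (rule ccontr)
      assume "u \<noteq> inv u"
      then have "(u, inv u) \<in> out_arcs (with_proj (unity_product_graph R)) u"
        using unit by (auto simp: unity_product_graph_def)
      then show False using no_out by simp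
    qed
    then have "u \<otimes> u = \<one>" using Units_r_inv[OF unit] by simp
    then show "u \<in> ?S" using unit by auto
  qed
  show "?S \<subseteq> ?I"
  proof
    fix u assume "u \<in> ?S"
    then have u: "u \<in> carrier R" "u \<otimes> u = \<one>" by auto
    then have unit: "u \<in> Units R" unfolding Units_def by auto
    have right: "v = u" if "v \<in> Units R" "u \<otimes> v = \<one>" for v
      using inv_unique[OF u(2) that(2)] that(1) u(1) by auto
    have left: "v = u" if "v \<in> Units R" "v \<otimes> u = \<one>" for v
      using inv_unique[OF that(2) u(2)] that(1) u(1) by auto
    show "u \<in> ?I"
      using unit by (auto simp: isolated_vertices_def unity_product_graph_def
          in_arcs_def out_arcs_def dest: left right)
  qed
qed

lemma card_square_roots_of_one_ring_iso:
  assumes "ring R" "R \<simeq> S"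
  shows "card {u \<in> carrier R. u \<otimes>\<^bsub>R\<^esub> u = \<one>\<^bsub>R\<^esub>} =
         card {x \<in> carrier S. x \<otimes>\<^bsub>S\<^esub> x = \<one>\<^bsub>S\<^esub>}"  (is "card ?A = card ?B")
proof -
  obtain f where "f \<in> ring_iso R S"
    using assms(2) by (auto simp: is_ring_iso_def)
  then have hom: "f \<in> ring_hom R S" and bij: "bij_betw f (carrier R) (carrier S)"
    by (auto simp: ring_iso_def)
  have sq: "f u \<otimes>\<^bsub>S\<^esub> f u = \<one>\<^bsub>S\<^esub> \<longleftrightarrow> u \<otimes>\<^bsub>R\<^esub> u = \<one>\<^bsub>R\<^esub>" if u: "u \<in> carrier R" for u
  proof -
    interpret R: ring R by fact
    have "f u \<otimes>\<^bsub>S\<^esub> f u = f (u \<otimes>\<^bsub>R\<^esub> u)" "f \<one>\<^bsub>R\<^esub> = \<one>\<^bsub>S\<^esub>"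
      using ring_hom_mult[OF hom u u] ring_hom_one[OF hom] by simp_all
    then show ?thesis
      using inj_on_eq_iff[OF bij_betw_imp_inj_on[OF bij]] u R.m_closed R.one_closed by metis
  qed
  have "f ` ?A = ?B"
  proof
    show "f ` ?A \<subseteq> ?B" using bij_betw_apply[OF bij] sq by auto
    show "?B \<subseteq> f ` ?A"
    proof
      fix x assume x: "x \<in> ?B"
      then obtain u where "u \<in> carrier R" "x = f u"
        using bij_betw_imp_surj_on[OF bij] by blast
      then show "x \<in> f ` ?A" using x sq by auto
    qed
  qed
  moreover have "inj_on f ?A"
    using bij_betw_imp_inj_on[OF bij] by (rule inj_on_subset) auto
  ultimately show ?thesis using card_image[of f ?A] by simp
qed

text \<open>As \<open>x\<close> is odd, \<open>x - 1\<close> and \<open>x + 1\<close> are consecutive even numbers, so one of them is divisible by two only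
  once. The other therefore takes all but one of the factors two of the product \<open>x\<^sup>2 - 1\<close>, which is
  why exactly one power of two is lost.\<close>

lemma square_cong_1_mod_power_two_imp:
  fixes x :: int
  assumes "2 ^ (k + 2) dvd x\<^sup>2 - 1"
  shows "2 ^ (k + 1) dvd x - 1 \<or> 2 ^ (k + 1) dvd x + 1"
proof -
  have "2 dvd x\<^sup>2 - 1"
    using assms by (rule dvd_trans[rotated]) simp
  then have "odd x" by simp
  then obtain y where x: "x = 2 * y + 1" by (elim oddE)
  have "x\<^sup>2 - 1 = 4 * (y * (y + 1))"
    by (simp add: x power2_eq_square algebra_simps)
  then have dvd: "2 ^ k dvd y * (y + 1)" using assms by simp
  have "2 ^ k dvd y \<or> 2 ^ k dvd y + 1"
  proof (cases "even y")
    case True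
    then have "coprime (2 ^ k) (y + 1)" by simp
    then show ?thesis using dvd by (simp add: coprime_dvd_mult_left_iff)
  next
    case False
    then have "coprime (2 ^ k) y" by simp
    then show ?thesis using dvd by (simp add: coprime_dvd_mult_right_iff)
  qed
  then have "2 * 2 ^ k dvd 2 * y \<or> 2 * 2 ^ k dvd 2 * (y + 1)"
    by (simp only: dvd_mult_cancel_left) simp
  moreover have "x - 1 = 2 * y" "x + 1 = 2 * (y + 1)" by (simp_all add: x)
  moreover have "(2::int) ^ (k + 1) = 2 * 2 ^ k" by simp
  ultimately show ?thesis by metis
qed

lemma square_roots_of_one_mod_power_two:
  fixes k :: nat
  defines "h \<equiv> (2::int) ^ (k + 2)"
  shows "{x \<in> {0..2 * h - 1}. x * x mod (2 * h) = 1} = {1, h - 1, h + 1, 2 * h - 1}"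
proof -
  have h: "h \<ge> 4" by (simp add: h_def)
  have root_iff: "x * x mod (2 * h) = 1 \<longleftrightarrow> 2 * h dvd x\<^sup>2 - 1" for x
  proof -
    have "1 mod (2 * h) = 1" using h by simp
    then show ?thesis
      using mod_eq_dvd_iff[of "x * x" "2 * h" 1] by (simp add: power2_eq_square)
  qed
  have "x \<in> {1, h - 1, h + 1, 2 * h - 1}"
    if x: "0 \<le> x" "x \<le> 2 * h - 1" and root: "2 * h dvd x\<^sup>2 - 1" for x
  proof -
    have "h dvd x - 1 \<or> h dvd x + 1"
      using square_cong_1_mod_power_two_imp[of "k + 1" x] root by (simp add: h_def)
    then obtain c where c: "x - 1 = h * c \<or> x + 1 = h * c"
      unfolding dvd_def by blast
    have "h * (-1) < h * c" "h * c < h * 3" using c x h by linarith+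
    then have "-1 < c" "c < 3" using h by (simp_all only: mult_less_cancel_left_pos)
    then have "c = 0 \<or> c = 1 \<or> c = 2" by auto
    then show ?thesis using c x h by auto
  qed
  \<comment> \<open>For \<open>h \<plusminus> 1\<close> the cofactor \<open>h \<plusminus> 2\<close> supplies the missing factor of two, as \<open>h\<close> is even.\<close>
  moreover have "2 * h dvd x\<^sup>2 - 1" if "x \<in> {1, h - 1, h + 1, 2 * h - 1}" for x
  proof -
    have "even h" by (simp add: h_def)
    then have "h * 2 dvd h * (h - 2)" "h * 2 dvd h * (h + 2)"
      by (intro mult_dvd_mono; simp)+
    moreover have "(h - 1)\<^sup>2 - 1 = h * (h - 2)" "(h + 1)\<^sup>2 - 1 = h * (h + 2)"
      "(2 * h - 1)\<^sup>2 - 1 = 2 * h * (2 * h - 2)"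
      by (simp_all add: power2_eq_square algebra_simps)
    ultimately show ?thesis using that by (auto simp: mult.commute)
  qed
  ultimately show ?thesis using h by (auto simp: root_iff)
qed

theorem theorem3p5:
  fixes R :: "('a, 'b) ring_scheme" and m :: nat
  assumes "ring R"
    and "m \<ge> 3"
    and "R \<simeq> residue_ring (2 ^ m)"
  shows "card (isolated_vertices (with_proj (unity_product_graph R))) = 4"
proof -
  interpret ring R by fact
  obtain k where m: "m = k + 3" using assms(2) by (metis le_add_diff_inverse2)
  define h :: int where "h = 2 ^ (k + 2)"
  have pow: "(2::int) ^ m = 2 * h" and h: "h \<ge> 4" by (simp_all add: m h_def power_add)
  interpret Z: residues "2 * h" "residue_ring (2 * h)"
    using h by unfold_locales simp_all
  have "card (isolated_vertices (with_proj (unity_product_graph R))) =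
        card {x \<in> {0..2 * h - 1}. x * x mod (2 * h) = 1}"
    using card_square_roots_of_one_ring_iso[OF assms(1,3)]
    by (simp add: isolated_vertices_unity_product_graph pow
        Z.res_carrier_eq Z.res_mult_eq Z.res_one_eq)
  also have "\<dots> = card {1, h - 1, h + 1, 2 * h - 1}"
    using square_roots_of_one_mod_power_two[of k] by (simp add: h_def)
  also have "\<dots> = 4" using h by simp
  finally show ?thesis .
qed

end
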